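(* Every compact $0$-dimensional metric space is $CT_4$.
   Context: All topological spaces are assumed to be non-empty. For a space $X$, $\mathrm{Cld}(X)$ denotes the set of all non-empty closed subsets of $X$, endowed with the Vietoris topology, i.e. the topology having as a subbase all sets $U^-=\{F\in\mathrm{Cld}(X): F\cap U\neq\emptyset\}$ and $U^+=\{F\in\mathrm{Cld}(X): F\subseteq U\}$ with $U$ open in $X$. Let $\mathcal{T}_4(X)=\{(F_1,F_2)\in\mathrm{Cld}(X)^2: F_1\cap F_2=\emptyset\}$, with the subspace topology from the product space $\mathrm{Cld}(X)^2$. The space $X$ is called $CT_4$ if there is a continuous map $\phi=(\phi_1,\phi_2):\mathcal{T}_4(X)\to\mathrm{Cld}(X)^2$ such that for every $(F_1,F_2)\in\mathcal{T}_4(X)$: $\phi_1(F_1,F_2)\cup\phi_2(F_1,F_2)=X$ and $F_j\cap\phi_j(F_1,F_2)=\emptyset$ for $j=1,2$. *)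

theory Defs
  imports "HOL-Analysis.Analysis"
begin

definition Cld :: "'a topology \<Rightarrow> 'a set set" where
  "Cld X = {F. closedin X F \<and> F \<noteq> {}}"

definition vietoris_minus :: "'a topology \<Rightarrow> 'a set \<Rightarrow> 'a set set" where
  "vietoris_minus X U = {F \<in> Cld X. F \<inter> U \<noteq> {}}"

definition vietoris_plus :: "'a topology \<Rightarrow> 'a set \<Rightarrow> 'a set set" where
  "vietoris_plus X U = {F \<in> Cld X. F \<subseteq> U}"

definition vietoris_topology :: "'a topology \<Rightarrow> 'a set topology" where
  "vietoris_topology X =
     topology_generated_by
       ({vietoris_minus X U | U. openin X U} \<union> {vietoris_plus X U | U. openin X U})"

lemma topspace_vietoris_topology [simp]: "topspace (vietoris_topology X) = Cld X"
proof
  show "topspace (vietoris_topology X) \<subseteq> Cld X"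
    unfolding vietoris_topology_def topology_generated_by_topspace
    by (auto simp: vietoris_plus_def vietoris_minus_def)
  have "vietoris_plus X (topspace X) = Cld X"
    by (auto simp: vietoris_plus_def Cld_def dest: closedin_subset)
  then show "Cld X \<subseteq> topspace (vietoris_topology X)"
    unfolding vietoris_topology_def topology_generated_by_topspace
    using openin_topspace by blast
qed

definition T4_pairs :: "'a topology \<Rightarrow> ('a set \<times> 'a set) set" where
  "T4_pairs X = {(F1, F2). F1 \<in> Cld X \<and> F2 \<in> Cld X \<and> F1 \<inter> F2 = {}}"

definition CT4_space :: "'a topology \<Rightarrow> bool" where
  "CT4_space X \<longleftrightarrow>
     (\<exists>\<phi>. continuous_map
            (subtopology (prod_topology (vietoris_topology X) (vietoris_topology X)) (T4_pairs X))
            (prod_topology (vietoris_topology X) (vietoris_topology X)) \<phi> \<and>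
          (\<forall>(F1, F2) \<in> T4_pairs X.
             fst (\<phi> (F1, F2)) \<union> snd (\<phi> (F1, F2)) = topspace X \<and>
             F1 \<inter> fst (\<phi> (F1, F2)) = {} \<and>
             F2 \<inter> snd (\<phi> (F1, F2)) = {}))"

end

theory Submission
  imports Defs
begin

text \<open>
  A compact zero-dimensional metric space has only countably many clopen subsets
  (\<open>countable_clopen\<close>), and they separate any two disjoint closed sets
  (\<open>clopen_between_compactin_openin\<close>).  Enumerate them as \<open>C\<^sub>0, C\<^sub>1, \<dots>\<close> and send a disjoint
  pair \<open>(F\<^sub>1, F\<^sub>2)\<close> to \<open>(X - C\<^sub>n, C\<^sub>n)\<close>, where \<open>n\<close> is the least index with
  \<open>F\<^sub>1 \<subseteq> C\<^sub>n\<close> and \<open>F\<^sub>2 \<subseteq> X - C\<^sub>n\<close>.  For a clopen set \<open>C\<close> the family of all closed \<open>F \<subseteq> C\<close> is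
  clopen in the Vietoris topology, because its complement is the family of all closed \<open>F\<close> that
  meet \<open>X - C\<close> (\<open>closedin_vietoris_plus\<close>).  Hence the condition that \<open>C\<^sub>n\<close> separates the pair is clopen in the pair, so the
  least index is locally constant, and the map, being locally constant, is continuous.
\<close>

lemma openin_vietoris_plus: "openin X U \<Longrightarrow> openin (vietoris_topology X) (vietoris_plus X U)"
  unfolding vietoris_topology_def by (rule topology_generated_by_Basis) blast

lemma openin_vietoris_minus: "openin X U \<Longrightarrow> openin (vietoris_topology X) (vietoris_minus X U)"
  unfolding vietoris_topology_def by (rule topology_generated_by_Basis) blast

lemma closedin_vietoris_plus:
  assumes "closedin X C"
  shows "closedin (vietoris_topology X) (vietoris_plus X C)"
proof -
  have "Cld X - vietoris_plus X C = vietoris_minus X (topspace X - C)"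
    by (auto simp: vietoris_plus_def vietoris_minus_def Cld_def dest: closedin_subset)
  moreover have "vietoris_plus X C \<subseteq> Cld X"
    by (auto simp: vietoris_plus_def)
  ultimately show ?thesis
    using assms by (simp add: closedin_def openin_vietoris_minus)
qed

lemma continuous_map_locally_constant:
  assumes im: "f \<in> topspace X \<rightarrow> topspace Y"
    and const: "\<And>x. x \<in> topspace X \<Longrightarrow> \<exists>U. openin X U \<and> x \<in> U \<and> (\<forall>y\<in>U. f y = f x)"
  shows "continuous_map X Y f"
  unfolding continuous_map_def
proof (intro conjI allI impI)
  fix V
  show "openin X {x \<in> topspace X. f x \<in> V}"
  proof (subst openin_subopen, intro ballI)
    fix x assume x: "x \<in> {x \<in> topspace X. f x \<in> V}"
    then obtain U where U: "openin X U" "x \<in> U" "\<forall>y\<in>U. f y = f x"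
      using const[of x] by auto
    have "U \<subseteq> {x \<in> topspace X. f x \<in> V}"
    proof
      fix y assume "y \<in> U"
      then show "y \<in> {x \<in> topspace X. f x \<in> V}"
        using openin_subset[OF U(1)] bspec[OF U(3)] x by auto
    qed
    with U(1,2) show "\<exists>T. openin X T \<and> x \<in> T \<and> T \<subseteq> {x \<in> topspace X. f x \<in> V}"
      by blast
  qed
qed (rule im)

lemma clopen_between_compactin_openin:
  assumes "X dim_le 0" "compactin X K" "openin X U" "K \<subseteq> U"
  obtains C where "closedin X C" "openin X C" "K \<subseteq> C" "C \<subseteq> U"
proof -
  let ?\<C> = "{C. closedin X C \<and> openin X C \<and> C \<subseteq> U}"
  have "neighbourhood_base_of (\<lambda>C. closedin X C \<and> openin X C) X"
    using assms(1) by (simp add: dimension_le_0_neighbourhood_base_of_clopen)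
  then have "K \<subseteq> \<Union>?\<C>"
    using assms(3,4) by (subst (asm) open_neighbourhood_base_of) blast+
  then obtain \<F> where \<F>: "finite \<F>" "\<F> \<subseteq> ?\<C>" "K \<subseteq> \<Union>\<F>"
    using compactinD[OF assms(2), of ?\<C>] by blast
  show thesis
  proof
    show "closedin X (\<Union>\<F>)" using \<F> by (intro closedin_Union) auto
    show "openin X (\<Union>\<F>)" using \<F> by (intro openin_Union) auto
  qed (use \<F> in auto)
qed

text \<open>In a compact space every clopen set is a finite union of members of a given base.\<close>

lemma countable_clopen:
  assumes "compact_space X" "second_countable X"
  shows "countable {C. closedin X C \<and> openin X C}"
proof -
  obtain \<B> where \<B>: "countable \<B>" "\<And>V. V \<in> \<B> \<Longrightarrow> openin X V"
    "\<And>U x. openin X U \<and> x \<in> U \<Longrightarrow> \<exists>V\<in>\<B>. x \<in> V \<and> V \<subseteq> U"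
    using assms(2) by (auto simp: second_countable_def)
  have "C \<in> Union ` {\<F>. finite \<F> \<and> \<F> \<subseteq> \<B>}" if "closedin X C" "openin X C" for C
  proof -
    have "compactin X C"
      using assms(1) that(1) by (rule closedin_compact_space)
    moreover have "C \<subseteq> \<Union>{V\<in>\<B>. V \<subseteq> C}"
      using \<B>(3) that(2) by blast
    ultimately obtain \<F> where \<F>: "finite \<F>" "\<F> \<subseteq> {V\<in>\<B>. V \<subseteq> C}" "C \<subseteq> \<Union>\<F>"
      using compactinD[of X C "{V\<in>\<B>. V \<subseteq> C}"] \<B>(2) by blast
    then have "C = \<Union>\<F>" "\<F> \<subseteq> \<B>" by auto
    with \<F>(1) show ?thesis by blast
  qed
  moreover have "countable (Union ` {\<F>. finite \<F> \<and> \<F> \<subseteq> \<B>})"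
    using \<B>(1) by (intro countable_image countable_Collect_finite_subset)
  ultimately show ?thesis
    by (elim countable_subset[rotated]) auto
qed

lemma (in Metric_space) compact_space_imp_second_countable:
  assumes "compact_space mtopology"
  shows "second_countable mtopology"
proof -
  have "\<exists>K. finite K \<and> K \<subseteq> M \<and> M \<subseteq> (\<Union>x\<in>K. mball x (inverse (real (Suc n))))" for n
    using assms unfolding compact_space_eq_mcomplete_mtotally_bounded mtotally_bounded_def by simp
  then obtain K where K: "\<And>n. finite (K n)" "\<And>n. K n \<subseteq> M"
    "\<And>n. M \<subseteq> (\<Union>x\<in>K n. mball x (inverse (real (Suc n))))"
    by metis
  let ?\<B> = "\<Union>n. (\<lambda>x. mball x (inverse (real (Suc n)))) ` K n"
  have "\<exists>V\<in>?\<B>. x \<in> V \<and> V \<subseteq> U" if U: "openin mtopology U" and x: "x \<in> U" for U x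
  proof -
    obtain r where r: "r > 0" "mball x r \<subseteq> U" and "x \<in> M"
      using U x unfolding openin_mtopology by blast
    obtain n where n: "inverse (real (Suc n)) < r / 2"
      using reals_Archimedean[of "r / 2"] r(1) by auto
    obtain z where z: "z \<in> K n" "x \<in> mball z (inverse (real (Suc n)))"
      using K(3)[of n] \<open>x \<in> M\<close> by blast
    have "mball z (inverse (real (Suc n))) \<subseteq> mball x r"
    proof
      fix y assume y: "y \<in> mball z (inverse (real (Suc n)))"
      then have "d x y \<le> d z x + d z y"
        using z(2) by (metis commute in_mball triangle)
      also have "\<dots> < r"
        using y z(2) n by simp
      finally show "y \<in> mball x r"
        using y \<open>x \<in> M\<close> by simp
    qed
    then have "mball z (inverse (real (Suc n))) \<subseteq> U"
      using r(2) by (rule subset_trans)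
    moreover have "mball z (inverse (real (Suc n))) \<in> ?\<B>"
      using z(1) by (intro UN_I[of n] imageI) simp_all
    ultimately show ?thesis
      using z(2) by (intro bexI conjI)
  qed
  moreover have "countable ?\<B>"
    using K(1) by (intro countable_UN[OF countableI_type] countable_image countable_finite)
  moreover have "\<forall>V\<in>?\<B>. openin mtopology V"
    by (intro ballI, elim UN_E imageE) simp
  ultimately show ?thesis
    unfolding second_countable_def by (intro exI[of _ ?\<B>]) simp
qed

text \<open>
  The selection argument needs nothing but a sequence of clopen sets that separates
  disjoint non-empty closed sets.
\<close>

lemma CT4_space_if_clopen_sequence:
  fixes C :: "nat \<Rightarrow> 'a set"
  assumes clo: "\<And>n. closedin X (C n)" and ope: "\<And>n. openin X (C n)"
    and sep: "\<And>F1 F2. (F1, F2) \<in> T4_pairs X \<Longrightarrow> \<exists>n. F1 \<subseteq> C n \<and> F2 \<subseteq> topspace X - C n"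
  shows "CT4_space X"
proof -
  let ?V = "vietoris_topology X"
  let ?T = "subtopology (prod_topology ?V ?V) (T4_pairs X)"
  define P where "P n = vietoris_plus X (C n) \<times> vietoris_plus X (topspace X - C n)" for n
  define N where "N p = (LEAST n. p \<in> P n)" for p
  define \<phi> where "\<phi> p = (topspace X - C (N p), C (N p))" for p
  have opeP: "openin (prod_topology ?V ?V) (P n)" for n
    unfolding P_def using clo ope
    by (intro openin_prod_Times_iff[THEN iffD2] disjI2 conjI openin_vietoris_plus) auto
  have cloP: "closedin (prod_topology ?V ?V) (P n)" for n
    unfolding P_def using clo ope
    by (intro closedin_prod_Times_iff[THEN iffD2] disjI2 conjI closedin_vietoris_plus) auto
  have P: "p \<in> P (N p)" if "p \<in> T4_pairs X" for p
  proof -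
    obtain F1 F2 where p: "p = (F1, F2)" by (cases p)
    then obtain n where "F1 \<subseteq> C n" "F2 \<subseteq> topspace X - C n"
      using \<open>p \<in> T4_pairs X\<close> sep by blast
    then have "p \<in> P n"
      using that by (auto simp: p P_def vietoris_plus_def T4_pairs_def)
    then show ?thesis unfolding N_def by (rule LeastI)
  qed
  have topT: "topspace ?T = T4_pairs X"
    by (auto simp: T4_pairs_def)
  have "continuous_map ?T (prod_topology ?V ?V) \<phi>"
  proof (rule continuous_map_locally_constant)
    \<comment> \<open>Both halves of the chosen partition are non-empty, as they contain members of the pair.\<close>
    have "\<phi> p \<in> Cld X \<times> Cld X" if "p \<in> T4_pairs X" for p
      using P[OF that] clo[of "N p"] ope[of "N p"]
      by (auto simp: \<phi>_def P_def vietoris_plus_def Cld_def)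
    then show "\<phi> \<in> topspace ?T \<rightarrow> topspace (prod_topology ?V ?V)"
      unfolding topT by simp
  next
    fix p assume "p \<in> topspace ?T"
    then have p: "p \<in> T4_pairs X" by (simp add: topT)
    \<comment> \<open>The pairs whose least separating index is the same as that of \<open>p\<close>.\<close>
    define U where "U = T4_pairs X \<inter> (P (N p) - (\<Union>m<N p. P m))"
    have "openin (prod_topology ?V ?V) (P (N p) - (\<Union>m<N p. P m))"
      using opeP cloP by (intro openin_diff closedin_Union) auto
    then have "openin ?T U"
      unfolding U_def by (rule openin_subtopology_Int2)
    moreover have "p \<notin> P m" if "m < N p" for m
      using that unfolding N_def by (rule not_less_Least)
    then have "p \<in> U"
      using p P[OF p] by (auto simp: U_def)
    moreover have "\<phi> q = \<phi> p" if "q \<in> U" for q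
    proof -
      have "N q = N p"
        unfolding N_def[of q] using that
        by (intro Least_equality) (auto simp: U_def intro: leI)
      then show ?thesis by (simp add: \<phi>_def)
    qed
    ultimately show "\<exists>U. openin ?T U \<and> p \<in> U \<and> (\<forall>q\<in>U. \<phi> q = \<phi> p)"
      by (intro exI[of _ U] conjI ballI)
  qed
  moreover have "\<forall>(F1, F2) \<in> T4_pairs X. fst (\<phi> (F1, F2)) \<union> snd (\<phi> (F1, F2)) = topspace X \<and>
      F1 \<inter> fst (\<phi> (F1, F2)) = {} \<and> F2 \<inter> snd (\<phi> (F1, F2)) = {}"
  proof clarify
    fix F1 F2 assume "(F1, F2) \<in> T4_pairs X"
    from P[OF this] closedin_subset[OF clo[of "N (F1, F2)"]]
    show "fst (\<phi> (F1, F2)) \<union> snd (\<phi> (F1, F2)) = topspace X \<and>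
      F1 \<inter> fst (\<phi> (F1, F2)) = {} \<and> F2 \<inter> snd (\<phi> (F1, F2)) = {}"
      by (auto simp: \<phi>_def P_def vietoris_plus_def)
  qed
  ultimately show ?thesis
    unfolding CT4_space_def by (intro exI[of _ \<phi>] conjI)
qed

theorem theorem3p6:
  fixes M :: "'a set" and d :: "'a \<Rightarrow> 'a \<Rightarrow> real"
  assumes "Metric_space M d"
    and "M \<noteq> {}"
    and "compact_space (Metric_space.mtopology M d)"
    and "Metric_space.mtopology M d dim_le 0"
  shows "CT4_space (Metric_space.mtopology M d)"
proof -
  interpret Metric_space M d by fact
  let ?\<C> = "{C. closedin mtopology C \<and> openin mtopology C}"
  have "countable ?\<C>"
    using assms(3) by (intro countable_clopen compact_space_imp_second_countable)
  moreover have "{} \<in> ?\<C>" by simp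
  ultimately have range: "range (from_nat_into ?\<C>) = ?\<C>"
    by (intro range_from_nat_into) blast+
  show ?thesis
  proof (rule CT4_space_if_clopen_sequence)
    show "closedin mtopology (from_nat_into ?\<C> n)" "openin mtopology (from_nat_into ?\<C> n)" for n
      using range by blast+
  next
    fix F1 F2 assume "(F1, F2) \<in> T4_pairs mtopology"
    then have F: "closedin mtopology F1" "closedin mtopology F2" "F1 \<inter> F2 = {}"
      by (auto simp: T4_pairs_def Cld_def)
    have "compactin mtopology F1"
      using assms(3) F(1) by (rule closedin_compact_space)
    moreover have "openin mtopology (topspace mtopology - F2)"
      using F(2) by (rule openin_diff[OF openin_topspace])
    moreover have "F1 \<subseteq> topspace mtopology - F2"
      using closedin_subset[OF F(1)] F(3) by blast
    ultimately obtain C where C: "closedin mtopology C" "openin mtopology C"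
      "F1 \<subseteq> C" "C \<subseteq> topspace mtopology - F2"
      by (rule clopen_between_compactin_openin[OF assms(4)])
    then have "C \<in> range (from_nat_into ?\<C>)"
      unfolding range by simp
    then obtain n where "C = from_nat_into ?\<C> n"
      by (rule rangeE)
    with C closedin_subset[OF F(2)]
    show "\<exists>n. F1 \<subseteq> from_nat_into ?\<C> n \<and> F2 \<subseteq> topspace mtopology - from_nat_into ?\<C> n"
      by (intro exI[of _ n]) blast
  qed
qed

end
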